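(* Assume that the proof system for ordinary Hoare triples (deriving judgments $\vdash \{\Phi\}\,\mathbb{P}\,\{\Phi'\}$) is sound and that the proof system for under-approximate Hoare triples (deriving judgments $\vdash [\Phi]\,\mathbb{P}\,[\Phi']$) is sound. If the Forall-Exist Hoare Tuple with precondition $\Phi$, universally quantified program list $\overline{\chi_\forall}$, existentially quantified program list $\overline{\chi_\exists}$ and postcondition $\Psi$ is derivable in Forall-Exist Hoare Logic, then this Forall-Exist Hoare Tuple is valid.
   Context: Programs are built from: skip; deterministic assignment $x := e$; $\mathtt{assume}(b)$; $\mathtt{if}(b,\mathbb{P},\mathbb{Q})$; $\mathtt{while}(b,\mathbb{P})$; sequential composition $\mathbb{P};\mathbb{Q}$; and nondeterministic assignment $x := \star$ (assigning an arbitrary integer). States are maps $\sigma:\mathcal{V}\to\mathbb{Z}$, and $[\![\mathbb{P}]\!](\sigma,\sigma')$ means $\mathbb{P}$ executed from $\sigma$ can terminate in $\sigma'$ (standard big-step semantics; $\mathtt{assume}(b)$ blocks on states violating $b$). For states over disjoint variable sets, $\sigma_1\oplus\sigma_2$ is the combined state; $\mathcal{V}_i=\{x_i\mid x\in\mathcal{V}\}$ are indexed variable copies. Assertions are first-order formulas over these variables. A Forall-Exist Hoare Tuple (FEHT) consists of a precondition $\Phi$ and postcondition $\Psi$ (assertions over $\bigcup_{i=1}^{k+l}\mathcal{V}_i$), a list $\overline{\chi_\forall}=\mathbb{P}_1,\ldots,\mathbb{P}_k$ of universally quantified programs and a list $\overline{\chi_\exists}=\mathbb{P}_{k+1},\ldots,\mathbb{P}_{k+l}$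 of existentially quantified programs, where $\mathbb{P}_i$ operates on $\mathcal{V}_i$. It is valid if for all states $\sigma_1,\ldots,\sigma_{k+l}$ and $\sigma'_1,\ldots,\sigma'_k$ with $\bigoplus_{i=1}^{k+l}\sigma_i\models\Phi$ and $[\![\mathbb{P}_i]\!](\sigma_i,\sigma'_i)$ for all $i\in[1,k]$, there exist $\sigma'_{k+1},\ldots,\sigma'_{k+l}$ with $[\![\mathbb{P}_i]\!](\sigma_i,\sigma'_i)$ for all $i\in[k+1,k+l]$ and $\bigoplus_{i=1}^{k+l}\sigma'_i\models\Psi$. A Hoare triple $\{\Phi\}\,\mathbb{P}\,\{\Phi'\}$ is valid if every terminating execution of $\mathbb{P}$ from a state satisfying $\Phi$ ends in a state satisfying $\Phi'$. An under-approximate Hoare triple $[\Phi]\,\mathbb{P}\,[\Phi']$ is valid if for every state $\sigma\models\Phi$ there exists $\sigma'$ with $[\![\mathbb{P}]\!](\sigma,\sigma')$ and $\sigma'\models\Phi'$. Forall-Exist Hoare Logic (FEHL) derives FEHTs with the following rules (each universal rule has an analogous existential counterpart where marked): reordering of the universal (resp. existential) program list; rewriting $\mathbb{P}$ to $\mathbb{P};\mathtt{skip}$ and eliminating a lone $\mathtt{skip}$ program (both sides); reassociating $(\mathbb{P}_1;\mathbb{P}_2);\mathbb{P}_3$ to $\mathbb{P}_1;(\mathbb{P}_2;\mathbb{P}_3)$ (both sides); (Done) deriving the tuple with both lists empty and pre- equal to postcondition; (Cons) strengthening the precondition and weakening the postcondition; (If) for $\mathtt{if}(b,\mathbb{P}_1,\mathbb{P}_2);\mathbb{P}_3$,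 splitting into premises with preconditions $\Phi\wedge b$ (program $\mathbb{P}_1;\mathbb{P}_3$) and $\Phi\wedge\neg b$ (program $\mathbb{P}_2;\mathbb{P}_3$) (both sides); ($\forall$-Step) for a universal program $\mathbb{P}_1;\mathbb{P}_2$, from $\vdash\{\Phi\}\,\mathbb{P}_1\,\{\Phi'\}$ and a derivation with precondition $\Phi'$ and $\mathbb{P}_2$ in its place; ($\exists$-Step) the same for an existential program using $\vdash[\Phi]\,\mathbb{P}_1\,[\Phi']$; ($\forall$-Assume) for universal $\mathtt{assume}(b);\mathbb{P}$, continue with precondition $\Phi\wedge b$; ($\exists$-Assume) for existential $\mathtt{assume}(b);\mathbb{P}$, require $\Phi\Rightarrow b$ and continue with $\mathbb{P}$; ($\forall$-Choice) for universal $x:=\star;\mathbb{P}$, continue with precondition $\exists x.\Phi$; ($\exists$-Choice) for existential $x:=\star;\mathbb{P}$, for any expression $e$ with $x\notin\mathit{Vars}(e)$, continue with precondition $(\exists x.\Phi)\wedge x=e$; havoc rules that drop a program $\mathbb{P}$ and existentially quantify its modified variables in the precondition (for existential programs additionally requiring $\vdash[\Phi]\,\mathbb{P}\,[\top]$); and a counting-based loop rule aligning the loops $\mathtt{while}(b_i,\mathbb{P}_i);\mathbb{Q}_i$ of all $k\ge1$ universal and $l$ existential programs via an invariant $\mathbb{I}$ (implied by $\Phi$, implying that all guards $b_i$ agree, with intermediate assertions $\mathbb{I}=\mathbb{I}_1,\ldots,\mathbb{I}_{B+1}=\mathbb{I}$ and counts $c_i\in[1,B]$ such that in round $j$ the bodies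 with $c_i\ge j$ are executed from $\mathbb{I}_j\wedge$ their guards to reach $\mathbb{I}_{j+1}\wedge$ the guards of loops with $c_i>j$), and continuing with the suffixes $\mathbb{Q}_i$ from $\mathbb{I}\wedge\bigwedge_i\neg b_i$. *)

theory Defs
  imports Main "HOL-Library.Multiset"
begin

section \<open>Expressions, programs and their semantics\<close>

text \<open>The signature is left arbitrary: function symbols \<open>'f\<close> and relation symbols \<open>'r\<close>, interpreted
  over the integers. Constants are nullary function symbols.\<close>

record ('f, 'r) interp =
  func_of :: "'f \<Rightarrow> int list \<Rightarrow> int"
  rel_of :: "'r \<Rightarrow> int list \<Rightarrow> bool"

type_synonym 'v state = "'v \<Rightarrow> int"

datatype (dead 'f, vars_exp: 'v) exp =
    Var 'v
  | Fn 'f "('f, 'v) exp list"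

datatype (dead 'f, dead 'r, 'v) bexp =
    BTrue
  | BEq "('f, 'v) exp" "('f, 'v) exp"
  | BRel 'r "('f, 'v) exp list"
  | BNot "('f, 'r, 'v) bexp"
  | BAnd "('f, 'r, 'v) bexp" "('f, 'r, 'v) bexp"

datatype (dead 'f, dead 'r, 'v) prog =
    Skip
  | Assign 'v "('f, 'v) exp"
  | Choose 'v  \<comment> \<open>nondeterministic assignment \<open>x := \<star>\<close>\<close>
  | Assume "('f, 'r, 'v) bexp"
  | If "('f, 'r, 'v) bexp" "('f, 'r, 'v) prog" "('f, 'r, 'v) prog"
  | While "('f, 'r, 'v) bexp" "('f, 'r, 'v) prog"
  | Seq "('f, 'r, 'v) prog" "('f, 'r, 'v) prog"  (infixr ";;" 60)

hide_const (open) If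

primrec eval_exp :: "('f, 'r) interp \<Rightarrow> 'v state \<Rightarrow> ('f, 'v) exp \<Rightarrow> int" where
  "eval_exp I s (Var x) = s x"
| "eval_exp I s (Fn f es) = func_of I f (map (eval_exp I s) es)"

primrec eval_bexp :: "('f, 'r) interp \<Rightarrow> 'v state \<Rightarrow> ('f, 'r, 'v) bexp \<Rightarrow> bool" where
  "eval_bexp I s BTrue \<longleftrightarrow> True"
| "eval_bexp I s (BEq e1 e2) \<longleftrightarrow> eval_exp I s e1 = eval_exp I s e2"
| "eval_bexp I s (BRel r es) \<longleftrightarrow> rel_of I r (map (eval_exp I s) es)"
| "eval_bexp I s (BNot b) \<longleftrightarrow> \<not> eval_bexp I s b"
| "eval_bexp I s (BAnd b1 b2) \<longleftrightarrow> eval_bexp I s b1 \<and> eval_bexp I s b2"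

inductive sem :: "('f, 'r) interp \<Rightarrow> ('f, 'r, 'v) prog \<Rightarrow> 'v state \<Rightarrow> 'v state \<Rightarrow> bool"
  for I :: "('f, 'r) interp" where
  Skip: "sem I Skip s s"
| Assign: "sem I (Assign x e) s (s(x := eval_exp I s e))"
| Choose: "sem I (Choose x) s (s(x := n))"
| Assume: "eval_bexp I s b \<Longrightarrow> sem I (Assume b) s s"
| IfTrue: "eval_bexp I s b \<Longrightarrow> sem I P s t \<Longrightarrow> sem I (prog.If b P Q) s t"
| IfFalse: "\<not> eval_bexp I s b \<Longrightarrow> sem I Q s t \<Longrightarrow> sem I (prog.If b P Q) s t"
| WhileFalse: "\<not> eval_bexp I s b \<Longrightarrow> sem I (While b P) s s"
| WhileTrue: "eval_bexp I s b \<Longrightarrow> sem I P s t \<Longrightarrow> sem I (While b P) t u \<Longrightarrow> sem I (While b P) s u"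
| Seq: "sem I P s t \<Longrightarrow> sem I Q t u \<Longrightarrow> sem I (P ;; Q) s u"

primrec mods :: "('f, 'r, 'v) prog \<Rightarrow> 'v list" where
  "mods Skip = []"
| "mods (Assign x e) = [x]"
| "mods (Choose x) = [x]"
| "mods (Assume b) = []"
| "mods (prog.If b P Q) = mods P @ mods Q"
| "mods (While b P) = mods P"
| "mods (P ;; Q) = mods P @ mods Q"

section \<open>First-order assertions\<close>

datatype (dead 'f, dead 'r, 'v) form =
    Bexp "('f, 'r, 'v) bexp"
  | Neg "('f, 'r, 'v) form"
  | And "('f, 'r, 'v) form" "('f, 'r, 'v) form"
  | Ex 'v "('f, 'r, 'v) form"

hide_const (open) Ex

primrec sat :: "('f, 'r) interp \<Rightarrow> 'v state \<Rightarrow> ('f, 'r, 'v) form \<Rightarrow> bool" where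
  "sat I s (Bexp b) \<longleftrightarrow> eval_bexp I s b"
| "sat I s (Neg \<Phi>) \<longleftrightarrow> \<not> sat I s \<Phi>"
| "sat I s (And \<Phi> \<Psi>) \<longleftrightarrow> sat I s \<Phi> \<and> sat I s \<Psi>"
| "sat I s (form.Ex x \<Phi>) \<longleftrightarrow> (\<exists>n. sat I (s(x := n)) \<Phi>)"

primrec free_vars :: "('f, 'r, 'v) form \<Rightarrow> 'v set" where
  "free_vars (Bexp b) = set_bexp b"
| "free_vars (Neg \<Phi>) = free_vars \<Phi>"
| "free_vars (And \<Phi> \<Psi>) = free_vars \<Phi> \<union> free_vars \<Psi>"
| "free_vars (form.Ex x \<Phi>) = free_vars \<Phi> - {x}"

abbreviation Top :: "('f, 'r, 'v) form" where
  "Top \<equiv> Bexp BTrue"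

definition Iff :: "('f, 'r, 'v) form \<Rightarrow> ('f, 'r, 'v) form \<Rightarrow> ('f, 'r, 'v) form" where
  "Iff \<Phi> \<Psi> = And (Neg (And \<Phi> (Neg \<Psi>))) (Neg (And \<Psi> (Neg \<Phi>)))"

definition Conj :: "('f, 'r, 'v) form list \<Rightarrow> ('f, 'r, 'v) form" where
  "Conj \<Phi>s = foldr And \<Phi>s Top"

definition Exs :: "'v list \<Rightarrow> ('f, 'r, 'v) form \<Rightarrow> ('f, 'r, 'v) form" where
  "Exs xs \<Phi> = foldr form.Ex xs \<Phi>"

definition entails :: "('f, 'r) interp \<Rightarrow> ('f, 'r, 'v) form \<Rightarrow> ('f, 'r, 'v) form \<Rightarrow> bool" where
  "entails I \<Phi> \<Psi> \<longleftrightarrow> (\<forall>s. sat I s \<Phi> \<longrightarrow> sat I s \<Psi>)"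

definition hoare_valid ::
    "('f, 'r) interp \<Rightarrow> ('f, 'r, 'v) form \<Rightarrow> ('f, 'r, 'v) prog \<Rightarrow> ('f, 'r, 'v) form \<Rightarrow> bool" where
  "hoare_valid I \<Phi> P \<Phi>' \<longleftrightarrow> (\<forall>s s'. sat I s \<Phi> \<longrightarrow> sem I P s s' \<longrightarrow> sat I s' \<Phi>')"

definition under_valid ::
    "('f, 'r) interp \<Rightarrow> ('f, 'r, 'v) form \<Rightarrow> ('f, 'r, 'v) prog \<Rightarrow> ('f, 'r, 'v) form \<Rightarrow> bool" where
  "under_valid I \<Phi> P \<Phi>' \<longleftrightarrow> (\<forall>s. sat I s \<Phi> \<longrightarrow> (\<exists>s'. sem I P s s' \<and> sat I s' \<Phi>'))"

section \<open>Forall-Exist Hoare Tuples\<close>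

text \<open>The indexed variable \<open>x\<^sub>i\<close> is the pair \<open>(x, i)\<close>. A program of a tuple is paired with the index
  of the copy of the variables on which it operates: since the rules permute the lists and remove
  programs from them, the position in the list does not determine that copy.\<close>

type_synonym 'v ivar = "'v \<times> nat"
type_synonym ('f, 'r, 'v) iprog = "nat \<times> ('f, 'r, 'v) prog"

abbreviation prog_at :: "nat \<Rightarrow> ('f, 'r, 'v) prog \<Rightarrow> ('f, 'r, 'v ivar) prog" where
  "prog_at i P \<equiv> map_prog (\<lambda>x. (x, i)) P"

abbreviation guard_at :: "nat \<Rightarrow> ('f, 'r, 'v) bexp \<Rightarrow> ('f, 'r, 'v ivar) form" where
  "guard_at i b \<equiv> Bexp (map_bexp (\<lambda>x. (x, i)) b)"

definition combine :: "(nat \<Rightarrow> 'v state) \<Rightarrow> 'v ivar state" where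
  "combine \<sigma> = (\<lambda>(x, i). \<sigma> i x)"

text \<open>Assertions in a derivation may still mention copies whose program has already been eliminated;
  these copies keep their initial values. The lemma \<open>feht_valid_numbered\<close> below shows that nothing
  changes for tuples whose programs are numbered consecutively and whose postcondition speaks about
  their copies only.\<close>

definition feht_valid ::
    "('f, 'r) interp \<Rightarrow> ('f, 'r, 'v ivar) form \<Rightarrow> ('f, 'r, 'v) iprog list \<Rightarrow> ('f, 'r, 'v) iprog list
      \<Rightarrow> ('f, 'r, 'v ivar) form \<Rightarrow> bool" where
  "feht_valid I \<Phi> As Es \<Psi> \<longleftrightarrow>
    (\<forall>\<sigma> \<sigma>'. sat I (combine \<sigma>) \<Phi> \<and> (\<forall>(i, P) \<in> set As. sem I P (\<sigma> i) (\<sigma>' i)) \<longrightarrow>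
      (\<exists>\<tau>. (\<forall>(i, P) \<in> set Es. sem I P (\<sigma> i) (\<tau> i)) \<and>
        sat I (combine (\<lambda>i. if i \<in> fst ` set As then \<sigma>' i
                            else if i \<in> fst ` set Es then \<tau> i
                            else \<sigma> i)) \<Psi>))"

lemma eval_exp_cong: "(\<And>x. x \<in> vars_exp e \<Longrightarrow> s x = t x) \<Longrightarrow> eval_exp I s e = eval_exp I t e"
proof (induction e)
  case (Fn f es)
  have "map (eval_exp I s) es = map (eval_exp I t) es"
    by (intro list.map_cong0) (auto intro!: Fn.IH Fn.prems)
  then show ?case by (simp del: map_eq_conv)
qed simp

lemma eval_bexp_cong: "(\<And>x. x \<in> set_bexp b \<Longrightarrow> s x = t x) \<Longrightarrow> eval_bexp I s b = eval_bexp I t b"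
proof (induction b)
  case (BEq e1 e2)
  then show ?case using eval_exp_cong[of e1 s t I] eval_exp_cong[of e2 s t I] by simp
next
  case (BRel r es)
  then have "map (eval_exp I s) es = map (eval_exp I t) es"
    by (auto intro!: eval_exp_cong)
  then show ?case by (simp del: map_eq_conv)
next
  case (BNot b)
  then have "eval_bexp I s b = eval_bexp I t b" by simp
  then show ?case by simp
next
  case (BAnd b1 b2)
  then have "eval_bexp I s b1 = eval_bexp I t b1" "eval_bexp I s b2 = eval_bexp I t b2" by simp_all
  then show ?case by simp
qed simp

lemma sat_cong: "(\<And>x. x \<in> free_vars \<Phi> \<Longrightarrow> s x = t x) \<Longrightarrow> sat I s \<Phi> = sat I t \<Phi>"
proof (induction \<Phi> arbitrary: s t)
  case (Bexp b)
  then have "eval_bexp I s b = eval_bexp I t b" by (intro eval_bexp_cong) simp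
  then show ?case by simp
next
  case (Neg \<Phi>)
  have "sat I s \<Phi> = sat I t \<Phi>" by (rule Neg.IH) (use Neg.prems in auto)
  then show ?case by simp
next
  case (And \<Phi> \<Psi>)
  have "sat I s \<Phi> = sat I t \<Phi>" by (rule And.IH) (use And.prems in auto)
  moreover have "sat I s \<Psi> = sat I t \<Psi>" by (rule And.IH) (use And.prems in auto)
  ultimately show ?case by simp
next
  case (Ex x \<Phi>)
  have "sat I (s(x := n)) \<Phi> = sat I (t(x := n)) \<Phi>" for n
    by (rule Ex.IH) (use Ex.prems in auto)
  then show ?case by simp
qed

lemma ball_set_enumerate:
  "(\<forall>(i, P) \<in> set (enumerate m Ps). R i P) \<longleftrightarrow> (\<forall>i \<in> {m..<m + length Ps}. R i (Ps ! (i - m)))"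
proof
  assume L: "\<forall>(i, P) \<in> set (enumerate m Ps). R i P"
  show "\<forall>i \<in> {m..<m + length Ps}. R i (Ps ! (i - m))"
  proof
    fix i assume "i \<in> {m..<m + length Ps}"
    then have "(i, Ps ! (i - m)) \<in> set (enumerate m Ps)"
      by (auto simp: in_set_enumerate_eq)
    with L show "R i (Ps ! (i - m))" by auto
  qed
qed (auto simp: in_set_enumerate_eq)

lemma fst_set_enumerate: "fst ` set (enumerate m Ps) = {m..<m + length Ps}"
  unfolding set_map[symmetric] map_fst_enumerate by simp

lemma feht_valid_numbered:
  fixes \<Phi> \<Psi> :: "('f, 'r, 'v ivar) form" and Ps Qs :: "('f, 'r, 'v) prog list"
  assumes "free_vars \<Psi> \<subseteq> {(x, i). i \<in> {1..length Ps + length Qs}}"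
  defines "k \<equiv> length Ps" and "l \<equiv> length Qs"
  shows "feht_valid I \<Phi> (enumerate 1 Ps) (enumerate (k + 1) Qs) \<Psi> \<longleftrightarrow>
    (\<forall>\<sigma> \<sigma>'. sat I (combine \<sigma>) \<Phi> \<and> (\<forall>i \<in> {1..k}. sem I (Ps ! (i - 1)) (\<sigma> i) (\<sigma>' i)) \<longrightarrow>
      (\<exists>\<tau>. (\<forall>i \<in> {1..k}. \<tau> i = \<sigma>' i) \<and>
           (\<forall>i \<in> {k + 1..k + l}. sem I (Qs ! (i - (k + 1))) (\<sigma> i) (\<tau> i)) \<and>
           sat I (combine \<tau>) \<Psi>))"
    (is "?L = ?R")
proof -
  have sets: "{1..<1 + k} = {1..k}" "{k + 1..<k + 1 + l} = {k + 1..k + l}"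
    by auto
  define fin where "fin \<sigma> \<sigma>' \<tau> = (\<lambda>i. if i \<in> {1..k} then \<sigma>' i
      else if i \<in> {k + 1..k + l} then \<tau> i else \<sigma> i)" for \<sigma> \<sigma>' \<tau> :: "nat \<Rightarrow> 'v state"
  have L: "?L \<longleftrightarrow> (\<forall>\<sigma> \<sigma>'. sat I (combine \<sigma>) \<Phi> \<and> (\<forall>i \<in> {1..k}. sem I (Ps ! (i - 1)) (\<sigma> i) (\<sigma>' i)) \<longrightarrow>
      (\<exists>\<tau>. (\<forall>i \<in> {k + 1..k + l}. sem I (Qs ! (i - (k + 1))) (\<sigma> i) (\<tau> i)) \<and>
           sat I (combine (fin \<sigma> \<sigma>' \<tau>)) \<Psi>))"
    unfolding feht_valid_def ball_set_enumerate fst_set_enumerate fin_def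
      k_def[symmetric] l_def[symmetric] sets ..
  have sat_fin: "sat I (combine (fin \<sigma> \<sigma>' \<tau>)) \<Psi> = sat I (combine \<tau>) \<Psi>"
    if "\<forall>i \<in> {1..k}. \<tau> i = \<sigma>' i" for \<sigma> \<sigma>' \<tau>
    by (rule sat_cong) (use assms(1) that in \<open>auto simp: combine_def fin_def k_def l_def\<close>)
  have fin_univ: "\<forall>i \<in> {1..k}. fin \<sigma> \<sigma>' \<tau> i = \<sigma>' i" for \<sigma> \<sigma>' \<tau>
    by (simp add: fin_def)
  have fin_ex: "\<forall>i \<in> {k + 1..k + l}. fin \<sigma> \<sigma>' \<tau> i = \<tau> i" for \<sigma> \<sigma>' \<tau>
    by (simp add: fin_def)
  have step: "(\<exists>\<tau>. (\<forall>i \<in> {k + 1..k + l}. sem I (Qs ! (i - (k + 1))) (\<sigma> i) (\<tau> i)) \<and>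
        sat I (combine (fin \<sigma> \<sigma>' \<tau>)) \<Psi>) \<longleftrightarrow>
      (\<exists>\<tau>. (\<forall>i \<in> {1..k}. \<tau> i = \<sigma>' i) \<and>
        (\<forall>i \<in> {k + 1..k + l}. sem I (Qs ! (i - (k + 1))) (\<sigma> i) (\<tau> i)) \<and> sat I (combine \<tau>) \<Psi>)"
    (is "?A = ?B") for \<sigma> \<sigma>'
  proof
    assume ?A
    then obtain \<tau> where "\<forall>i \<in> {k + 1..k + l}. sem I (Qs ! (i - (k + 1))) (\<sigma> i) (\<tau> i)"
      and "sat I (combine (fin \<sigma> \<sigma>' \<tau>)) \<Psi>" by blast
    then show ?B
      by (intro exI[of _ "fin \<sigma> \<sigma>' \<tau>"] conjI) (simp_all add: fin_univ fin_ex)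
  next
    assume ?B
    then show ?A using sat_fin by blast
  qed
  show ?thesis unfolding L step ..
qed

section \<open>Forall-Exist Hoare Logic\<close>

text \<open>\<open>H\<close> and \<open>U\<close> are the derivability judgments of the proof systems for ordinary and
  under-approximate Hoare triples.\<close>

inductive fehl ::
    "('f, 'r) interp
      \<Rightarrow> (('f, 'r, 'v ivar) form \<Rightarrow> ('f, 'r, 'v ivar) prog \<Rightarrow> ('f, 'r, 'v ivar) form \<Rightarrow> bool)
      \<Rightarrow> (('f, 'r, 'v ivar) form \<Rightarrow> ('f, 'r, 'v ivar) prog \<Rightarrow> ('f, 'r, 'v ivar) form \<Rightarrow> bool)
      \<Rightarrow> ('f, 'r, 'v ivar) form \<Rightarrow> ('f, 'r, 'v) iprog list \<Rightarrow> ('f, 'r, 'v) iprog list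
      \<Rightarrow> ('f, 'r, 'v ivar) form \<Rightarrow> bool"
  for I H U where
  A_Reorder:
    "mset As = mset As' \<Longrightarrow> fehl I H U \<Phi> As' Es \<Psi> \<Longrightarrow> fehl I H U \<Phi> As Es \<Psi>"
| E_Reorder:
    "mset Es = mset Es' \<Longrightarrow> fehl I H U \<Phi> As Es' \<Psi> \<Longrightarrow> fehl I H U \<Phi> As Es \<Psi>"
| A_Skip_I:
    "fehl I H U \<Phi> ((i, P ;; Skip) # As) Es \<Psi> \<Longrightarrow> fehl I H U \<Phi> ((i, P) # As) Es \<Psi>"
| E_Skip_I:
    "fehl I H U \<Phi> As ((i, P ;; Skip) # Es) \<Psi> \<Longrightarrow> fehl I H U \<Phi> As ((i, P) # Es) \<Psi>"
| A_Skip_E: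
    "fehl I H U \<Phi> As Es \<Psi> \<Longrightarrow> fehl I H U \<Phi> ((i, Skip) # As) Es \<Psi>"
| E_Skip_E:
    "fehl I H U \<Phi> As Es \<Psi> \<Longrightarrow> fehl I H U \<Phi> As ((i, Skip) # Es) \<Psi>"
| A_Assoc:
    "fehl I H U \<Phi> ((i, P1 ;; (P2 ;; P3)) # As) Es \<Psi>
      \<Longrightarrow> fehl I H U \<Phi> ((i, (P1 ;; P2) ;; P3) # As) Es \<Psi>"
| E_Assoc:
    "fehl I H U \<Phi> As ((i, P1 ;; (P2 ;; P3)) # Es) \<Psi>
      \<Longrightarrow> fehl I H U \<Phi> As ((i, (P1 ;; P2) ;; P3) # Es) \<Psi>"
| Done:
    "fehl I H U \<Phi> [] [] \<Phi>"
| Cons: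
    "entails I \<Phi> \<Phi>' \<Longrightarrow> fehl I H U \<Phi>' As Es \<Psi>' \<Longrightarrow> entails I \<Psi>' \<Psi> \<Longrightarrow> fehl I H U \<Phi> As Es \<Psi>"
| A_If:
    "fehl I H U (And \<Phi> (guard_at i b)) ((i, P1 ;; P3) # As) Es \<Psi>
      \<Longrightarrow> fehl I H U (And \<Phi> (Neg (guard_at i b))) ((i, P2 ;; P3) # As) Es \<Psi>
      \<Longrightarrow> fehl I H U \<Phi> ((i, prog.If b P1 P2 ;; P3) # As) Es \<Psi>"
| E_If:
    "fehl I H U (And \<Phi> (guard_at i b)) As ((i, P1 ;; P3) # Es) \<Psi>
      \<Longrightarrow> fehl I H U (And \<Phi> (Neg (guard_at i b))) As ((i, P2 ;; P3) # Es) \<Psi>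
      \<Longrightarrow> fehl I H U \<Phi> As ((i, prog.If b P1 P2 ;; P3) # Es) \<Psi>"
| A_Step:
    "H \<Phi> (prog_at i P1) \<Phi>' \<Longrightarrow> fehl I H U \<Phi>' ((i, P2) # As) Es \<Psi>
      \<Longrightarrow> fehl I H U \<Phi> ((i, P1 ;; P2) # As) Es \<Psi>"
| E_Step:
    "U \<Phi> (prog_at i P1) \<Phi>' \<Longrightarrow> fehl I H U \<Phi>' As ((i, P2) # Es) \<Psi>
      \<Longrightarrow> fehl I H U \<Phi> As ((i, P1 ;; P2) # Es) \<Psi>"
| A_Assume:
    "fehl I H U (And \<Phi> (guard_at i b)) ((i, P) # As) Es \<Psi>
      \<Longrightarrow> fehl I H U \<Phi> ((i, Assume b ;; P) # As) Es \<Psi>"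
| E_Assume:
    "entails I \<Phi> (guard_at i b) \<Longrightarrow> fehl I H U \<Phi> As ((i, P) # Es) \<Psi>
      \<Longrightarrow> fehl I H U \<Phi> As ((i, Assume b ;; P) # Es) \<Psi>"
| A_Choice:
    "fehl I H U (form.Ex (x, i) \<Phi>) ((i, P) # As) Es \<Psi>
      \<Longrightarrow> fehl I H U \<Phi> ((i, Choose x ;; P) # As) Es \<Psi>"
| E_Choice:
    "(x, i) \<notin> vars_exp e
      \<Longrightarrow> fehl I H U (And (form.Ex (x, i) \<Phi>) (Bexp (BEq (Var (x, i)) e))) As ((i, P) # Es) \<Psi>
      \<Longrightarrow> fehl I H U \<Phi> As ((i, Choose x ;; P) # Es) \<Psi>"
| A_Havoc:
    "fehl I H U (Exs (mods (prog_at i P)) \<Phi>) As Es \<Psi> \<Longrightarrow> fehl I H U \<Phi> ((i, P) # As) Es \<Psi>"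
| E_Havoc:
    "U \<Phi> (prog_at i P) Top \<Longrightarrow> fehl I H U (Exs (mods (prog_at i P)) \<Phi>) As Es \<Psi>
      \<Longrightarrow> fehl I H U \<Phi> As ((i, P) # Es) \<Psi>"
| Loop_Counting:
    \<comment> \<open>\<open>ix i\<close> is the variable copy of the \<open>i\<close>-th program, and \<open>J 1, \<dots>, J (B + 1)\<close> are the
      intermediate assertions of the rounds\<close>
    "k \<ge> 1
      \<Longrightarrow> entails I \<Phi> Inv
      \<Longrightarrow> (\<And>i j. i \<in> {1..k + l} \<Longrightarrow> j \<in> {1..k + l}
            \<Longrightarrow> entails I Inv (Iff (guard_at (ix i) (b i)) (guard_at (ix j) (b j))))
      \<Longrightarrow> (\<And>i. i \<in> {1..k + l} \<Longrightarrow> c i \<in> {1..B::nat})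
      \<Longrightarrow> (\<forall>j \<in> {1, B + 1}. J j = Inv)
      \<Longrightarrow> (\<And>j. j \<in> {1..B} \<Longrightarrow>
            fehl I H U
              (And (J j)
                (Conj (map (\<lambda>i. guard_at (ix i) (b i)) (filter (\<lambda>i. c i \<ge> j) [1..<k + l + 1]))))
              (map (\<lambda>i. (ix i, P i)) (filter (\<lambda>i. c i \<ge> j) [1..<k + 1]))
              (map (\<lambda>i. (ix i, P i)) (filter (\<lambda>i. c i \<ge> j) [k + 1..<k + l + 1]))
              (And (J (j + 1))
                (Conj (map (\<lambda>i. guard_at (ix i) (b i)) (filter (\<lambda>i. c i > j) [1..<k + l + 1])))))
      \<Longrightarrow> fehl I H U
            (And Inv (Conj (map (\<lambda>i. Neg (guard_at (ix i) (b i))) [1..<k + l + 1])))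
            (map (\<lambda>i. (ix i, Q i)) [1..<k + 1])
            (map (\<lambda>i. (ix i, Q i)) [k + 1..<k + l + 1])
            \<Psi>
      \<Longrightarrow> fehl I H U \<Phi>
            (map (\<lambda>i. (ix i, While (b i) (P i) ;; Q i)) [1..<k + 1])
            (map (\<lambda>i. (ix i, While (b i) (P i) ;; Q i)) [k + 1..<k + l + 1])
            \<Psi>"

end

theory Submission
  imports Defs
begin

text \<open>
  Soundness is proved by induction on the derivation. Apart from the loop rule, every rule either
  advances one program of the tuple, splits the precondition, or removes a trivial program; the
  first kind is captured by a single refinement principle for each quantifier.

  For the loop rule one fixes terminating runs of the universal loops and inducts on the number of
  iterations of the first of them. As long as the guards hold, the \<open>B\<close> rounds consume \<open>c i\<close>
  iterations of every universal loop and produce \<open>c i\<close> iterations of every existential one, and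
  \<open>c 1 \<ge> 1\<close>. When the guards fail, they fail simultaneously, so the existential loops exit together
  with the universal ones.
\<close>

section \<open>Programs on an indexed copy of the variables\<close>

lemma eval_exp_map: "eval_exp I s (map_exp f e) = eval_exp I (\<lambda>x. s (f x)) e"
proof (induction e)
  case (Fn g es)
  have "map (eval_exp I s) (map (map_exp f) es) = map (eval_exp I (\<lambda>x. s (f x))) es"
    using Fn.IH by simp
  then show ?case by (simp del: map_map map_eq_conv)
qed simp

lemma eval_bexp_map: "eval_bexp I s (map_bexp f b) = eval_bexp I (\<lambda>x. s (f x)) b"
proof (induction b)
  case (BRel r es)
  have "map (eval_exp I s) (map (map_exp f) es) = map (eval_exp I (\<lambda>x. s (f x))) es"
    by (simp add: eval_exp_map)
  then show ?case by (simp del: map_map map_eq_conv)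
qed (simp_all add: eval_exp_map)

lemma combine_apply [simp]: "combine \<sigma> (x, i) = \<sigma> i x"
  by (simp add: combine_def)

lemma combine_upd: "(combine \<sigma>)((x, i) := n) = combine (\<sigma>(i := (\<sigma> i)(x := n)))"
  by (auto simp: combine_def fun_eq_iff)

lemma eval_guard_at [simp]:
  "eval_bexp I (combine \<sigma>) (map_bexp (\<lambda>x. (x, i)) b) = eval_bexp I (\<sigma> i) b"
  by (simp add: eval_bexp_map)

lemma eval_exp_at [simp]:
  "eval_exp I (combine \<sigma>) (map_exp (\<lambda>x. (x, i)) e) = eval_exp I (\<sigma> i) e"
  by (simp add: eval_exp_map)

inductive_cases sem_SkipE [elim!]: "sem I Skip s t"
inductive_cases sem_AssumeE [elim!]: "sem I (Assume b) s t"
inductive_cases sem_ChooseE [elim!]: "sem I (Choose x) s t"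
inductive_cases sem_IfE [elim!]: "sem I (prog.If b P Q) s t"
inductive_cases sem_SeqE [elim!]: "sem I (P ;; Q) s t"

text \<open>The renamed program acts on component \<open>i\<close> alone, so a run of
  \<open>P\<close> carries over rule by rule. This lifts runs of universal programs to the combined
  states that Hoare triples speak about.\<close>

lemma sem_prog_at:
  assumes "sem I P (\<sigma> i) t"
  shows "sem I (prog_at i P) (combine \<sigma>) (combine (\<sigma>(i := t)))"
proof -
  define S where "S s = combine (\<sigma>(i := s))" for s
  have eval: "eval_exp I (S s) (map_exp (\<lambda>x. (x, i)) e) = eval_exp I s e"
    "eval_bexp I (S s) (map_bexp (\<lambda>x. (x, i)) b) = eval_bexp I s b" for s e b
    by (simp_all add: S_def)
  have upd: "(S s)((x, i) := n) = S (s(x := n))" for s x n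
    by (simp add: S_def combine_upd)
  have "sem I (prog_at i P) (S s) (S t)" if "sem I P s t" for s t
    using that
  proof (induction rule: sem.induct)
    case (Assign x e s)
    have "sem I (prog_at i (Assign x e)) (S s) (S (s(x := eval_exp I s e)))"
      using sem.Assign[of I "(x, i)" "map_exp (\<lambda>x. (x, i)) e" "S s"] by (simp add: eval upd)
    then show ?case by (simp add: fun_upd_def)
  next
    case (Choose x s n)
    have "sem I (prog_at i (Choose x)) (S s) (S (s(x := n)))"
      using sem.Choose[of I "(x, i)" "S s" n] by (simp add: upd)
    then show ?case by (simp add: fun_upd_def)
  qed (auto simp: eval intro: sem.intros)
  from this[OF assms] show ?thesis by (simp add: S_def)
qed

text \<open>An under-approximate triple yields just some state of all indexed variables. As the
  renamed program writes to copy \<open>i\<close> only, that state is again a combined one, and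
  \<open>P\<close> itself reaches its component \<open>i\<close>.\<close>

lemma sem_prog_atE:
  assumes "sem I (prog_at i P) (combine \<sigma>) T"
  obtains t where "T = combine (\<sigma>(i := t))" "sem I P (\<sigma> i) t"
proof -
  define reached where
    "reached P \<sigma> T \<longleftrightarrow> (\<exists>t. T = combine (\<sigma>(i := t)) \<and> sem I P (\<sigma> i) t)"
    for P :: "('a, 'b, 'c) prog" and \<sigma> T
  \<comment> \<open>Induction on the run of the renamed program with \<open>P\<close> generalised:
    in each case \<open>cases P\<close> recovers the original program from the shape of its
    image.\<close>
  have "reached P \<sigma> T" if "sem I R S T" "R = prog_at i P" "S = combine \<sigma>" for R S T
    using that
  proof (induction arbitrary: P \<sigma> rule: sem.induct)
    case (Skip s)
    then show ?case
      unfolding reached_def by (cases P) (auto intro!: exI[of _ "\<sigma> i"] sem.intros)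
  next
    case (Assign x e s)
    then show ?case
      unfolding reached_def by (cases P) (auto simp: combine_upd intro: sem.intros)
  next
    case (Choose x s n)
    then show ?case
      unfolding reached_def by (cases P) (auto simp: combine_upd intro: sem.intros)
  next
    case (Assume s b)
    then show ?case
      unfolding reached_def by (cases P) (auto intro!: exI[of _ "\<sigma> i"] sem.intros)
  next
    case (IfTrue s b P1 t P2)
    from IfTrue.prems obtain b' P1' P2' where P: "P = prog.If b' P1' P2'"
      and b: "b = map_bexp (\<lambda>x. (x, i)) b'" and branch: "P1 = prog_at i P1'"
      by (cases P) auto
    from IfTrue.IH[OF branch IfTrue.prems(2)] IfTrue.hyps(1) IfTrue.prems(2) show ?case
      unfolding reached_def by (auto simp: P b intro: sem.IfTrue)
  next
    case (IfFalse s b P2 t P1)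
    from IfFalse.prems obtain b' P1' P2' where P: "P = prog.If b' P1' P2'"
      and b: "b = map_bexp (\<lambda>x. (x, i)) b'" and branch: "P2 = prog_at i P2'"
      by (cases P) auto
    from IfFalse.IH[OF branch IfFalse.prems(2)] IfFalse.hyps(1) IfFalse.prems(2) show ?case
      unfolding reached_def by (auto simp: P b intro: sem.IfFalse)
  next
    case (WhileFalse s b P1)
    then show ?case
      unfolding reached_def by (cases P) (auto intro!: exI[of _ "\<sigma> i"] sem.WhileFalse)
  next
    case (WhileTrue s b P1 t u)
    from WhileTrue.prems obtain b' P' where P: "P = While b' P'"
      and b: "b = map_bexp (\<lambda>x. (x, i)) b'" and P1: "P1 = prog_at i P'"
      by (cases P) auto
    from WhileTrue.IH(1)[OF P1 WhileTrue.prems(2)] obtain t' where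
      t: "t = combine (\<sigma>(i := t'))" "sem I P' (\<sigma> i) t'" unfolding reached_def by blast
    \<comment> \<open>The remaining iterations start from \<open>\<sigma>(i := t')\<close>; the
      second update of component \<open>i\<close> overwrites the first.\<close>
    from WhileTrue.IH(2)[OF WhileTrue.prems(1)[unfolded P[symmetric]] t(1)] obtain u' where
      "u = combine (\<sigma>(i := u'))" "sem I P t' u'"
      unfolding reached_def by auto
    with t WhileTrue.hyps(1) WhileTrue.prems(2) show ?case
      unfolding reached_def by (auto simp: P b intro: sem.WhileTrue)
  next
    case (Seq P1 s t P2 u)
    from Seq.prems obtain P1' P2' where P: "P = P1' ;; P2'"
      and P1: "P1 = prog_at i P1'" and P2: "P2 = prog_at i P2'"
      by (cases P) auto
    from Seq.IH(1)[OF P1 Seq.prems(2)] obtain t' where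
      t: "t = combine (\<sigma>(i := t'))" "sem I P1' (\<sigma> i) t'" unfolding reached_def by blast
    from Seq.IH(2)[OF P2 t(1)] obtain u' where
      "u = combine (\<sigma>(i := u'))" "sem I P2' t' u'"
      unfolding reached_def by auto
    with t show ?case unfolding reached_def by (auto simp: P intro: sem.Seq)
  qed
  with assms that show thesis unfolding reached_def by blast
qed

section \<open>Modified variables and iterated quantifiers\<close>

lemma sem_mods: "sem I P s t \<Longrightarrow> x \<notin> set (mods P) \<Longrightarrow> t x = s x"
  by (induction rule: sem.induct) auto

text \<open>The old state \<open>s\<close> supplies the witnesses: restoring the listed variables to
  their values in \<open>s\<close> turns \<open>t\<close> back into \<open>s\<close>.\<close>

lemma sat_Exs:
  assumes "sat I s \<Phi>" "\<And>x. x \<notin> set xs \<Longrightarrow> t x = s x"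
  shows "sat I t (Exs xs \<Phi>)"
  using assms(2)
proof (induction xs arbitrary: t)
  case Nil
  then have "t = s" by auto
  with assms(1) show ?case by (simp add: Exs_def)
next
  case (Cons x xs)
  have "sat I (t(x := s x)) (Exs xs \<Phi>)"
    by (rule Cons.IH) (use Cons.prems in auto)
  then show ?case by (auto simp: Exs_def)
qed

text \<open>The core of both havoc rules: a run changes modified variables only, so the state before
  it witnesses the quantifiers after it.\<close>

lemma sat_Exs_mods:
  assumes "sat I (combine \<sigma>) \<Phi>" "sem I P (\<sigma> i) t"
  shows "sat I (combine (\<sigma>(i := t))) (Exs (mods (prog_at i P)) \<Phi>)"
  using assms(1) sem_mods[OF sem_prog_at[of I P \<sigma> i, OF assms(2)]] by (rule sat_Exs)

lemma sat_Conj: "sat I s (Conj \<Phi>s) \<longleftrightarrow> (\<forall>\<Phi> \<in> set \<Phi>s. sat I s \<Phi>)"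
  by (induction \<Phi>s) (auto simp: Conj_def)

section \<open>Validity as existence of a final state\<close>

text \<open>One total final state \<open>\<tau>\<close> replaces the case distinction in
  \<open>feht_valid\<close>: prescribed on universal copies, reached by execution on existential
  ones, initial elsewhere.\<close>

definition outcome ::
    "('f, 'r) interp \<Rightarrow> ('f, 'r, 'v) iprog list \<Rightarrow> ('f, 'r, 'v) iprog list
      \<Rightarrow> (nat \<Rightarrow> 'v state) \<Rightarrow> (nat \<Rightarrow> 'v state) \<Rightarrow> (nat \<Rightarrow> 'v state) \<Rightarrow> bool" where
  "outcome I As Es \<sigma> \<sigma>' \<tau> \<longleftrightarrow>
    (\<forall>i \<in> fst ` set As. \<tau> i = \<sigma>' i) \<and> (\<forall>(i, P) \<in> set Es. sem I P (\<sigma> i) (\<tau> i)) \<and>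
    (\<forall>i. i \<notin> fst ` set As \<longrightarrow> i \<notin> fst ` set Es \<longrightarrow> \<tau> i = \<sigma> i)"

lemma feht_validI:
  assumes "\<And>\<sigma> \<sigma>'. sat I (combine \<sigma>) \<Phi> \<Longrightarrow> \<forall>(i, P) \<in> set As. sem I P (\<sigma> i) (\<sigma>' i) \<Longrightarrow>
    \<exists>\<tau>. outcome I As Es \<sigma> \<sigma>' \<tau> \<and> sat I (combine \<tau>) \<Psi>"
  shows "feht_valid I \<Phi> As Es \<Psi>"
  unfolding feht_valid_def
proof (intro allI impI, elim conjE)
  fix \<sigma> \<sigma>' assume "sat I (combine \<sigma>) \<Phi>" "\<forall>(i, P) \<in> set As. sem I P (\<sigma> i) (\<sigma>' i)"
  from assms[OF this] obtain \<tau> where \<tau>: "outcome I As Es \<sigma> \<sigma>' \<tau>" "sat I (combine \<tau>) \<Psi>"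
    by blast
  then have "(\<lambda>i. if i \<in> fst ` set As then \<sigma>' i else if i \<in> fst ` set Es then \<tau> i else \<sigma> i) = \<tau>"
    unfolding outcome_def fun_eq_iff by auto
  with \<tau> show "\<exists>\<tau>. (\<forall>(i, P) \<in> set Es. sem I P (\<sigma> i) (\<tau> i)) \<and>
      sat I (combine (\<lambda>i. if i \<in> fst ` set As then \<sigma>' i
                          else if i \<in> fst ` set Es then \<tau> i else \<sigma> i)) \<Psi>"
    by (intro exI[of _ \<tau>]) (simp add: outcome_def)
qed

text \<open>Disjointness matters because \<open>feht_valid\<close> gives universal copies
  precedence: on a shared copy, \<open>\<sigma>'\<close> would overwrite the state reached by the
  existential program.\<close>

lemma feht_validE:
  assumes "feht_valid I \<Phi> As Es \<Psi>" "fst ` set As \<inter> fst ` set Es = {}"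
    and "sat I (combine \<sigma>) \<Phi>" "\<And>i P. (i, P) \<in> set As \<Longrightarrow> sem I P (\<sigma> i) (\<sigma>' i)"
  obtains \<tau> where "outcome I As Es \<sigma> \<sigma>' \<tau>" "sat I (combine \<tau>) \<Psi>"
proof -
  let ?fin = "\<lambda>\<tau> i. if i \<in> fst ` set As then \<sigma>' i else if i \<in> fst ` set Es then \<tau> i else \<sigma> i"
  from assms(1,3,4) obtain \<tau> where \<tau>: "\<forall>(i, P) \<in> set Es. sem I P (\<sigma> i) (\<tau> i)"
    and \<Psi>: "sat I (combine (?fin \<tau>)) \<Psi>"
    unfolding feht_valid_def by blast
  have "sem I P (\<sigma> i) (?fin \<tau> i)" if "(i, P) \<in> set Es" for i P
  proof -
    from that have "i \<in> fst ` set Es" by force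
    with assms(2) have "i \<notin> fst ` set As" by blast
    with \<tau> that \<open>i \<in> fst ` set Es\<close> show ?thesis by auto
  qed
  then have "outcome I As Es \<sigma> \<sigma>' (?fin \<tau>)" by (auto simp: outcome_def)
  with \<Psi> that show thesis by blast
qed

section \<open>Refinement of a single program\<close>

text \<open>Moving component \<open>i\<close> to \<open>u\<close> establishes the precondition of
  the premise while the final state \<open>t\<close> stays the same, so the existential answer can
  be reused. Here \<open>u\<close> may depend on \<open>t\<close>, since universal runs are
  given.\<close>

lemma feht_valid_A_refine:
  assumes "feht_valid I \<Phi>' ((i, P') # As) Es \<Psi>" "distinct (map fst (((i, P) # As) @ Es))"
    and step: "\<And>\<sigma> t. sat I (combine \<sigma>) \<Phi> \<Longrightarrow> sem I P (\<sigma> i) t \<Longrightarrow>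
      \<exists>u. sat I (combine (\<sigma>(i := u))) \<Phi>' \<and> sem I P' u t"
  shows "feht_valid I \<Phi> ((i, P) # As) Es \<Psi>"
proof (rule feht_validI)
  fix \<sigma> \<sigma>' assume \<Phi>: "sat I (combine \<sigma>) \<Phi>"
    and As: "\<forall>(j, Q) \<in> set ((i, P) # As). sem I Q (\<sigma> j) (\<sigma>' j)"
  then obtain u where u: "sat I (combine (\<sigma>(i := u))) \<Phi>'" "sem I P' u (\<sigma>' i)"
    using step[of \<sigma> "\<sigma>' i"] by auto
  \<comment> \<open>No other program uses copy \<open>i\<close>, so moving its component to
    \<open>u\<close> leaves all other runs intact.\<close>
  have fresh: "(i, R) \<notin> set As" "(i, R) \<notin> set Es" for R using assms(2) by force+
  obtain \<tau> where \<tau>: "outcome I ((i, P') # As) Es (\<sigma>(i := u)) \<sigma>' \<tau>" "sat I (combine \<tau>) \<Psi>"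
  proof (rule feht_validE[OF assms(1) _ u(1)])
    show "fst ` set ((i, P') # As) \<inter> fst ` set Es = {}" using assms(2) by auto
    show "sem I Q ((\<sigma>(i := u)) j) (\<sigma>' j)" if "(j, Q) \<in> set ((i, P') # As)" for j Q
      using that As u(2) fresh by (cases "j = i") auto
  qed
  have "sem I Q (\<sigma> j) (\<tau> j)" if "(j, Q) \<in> set Es" for j Q
  proof -
    from that fresh have "j \<noteq> i" by blast
    with that \<tau>(1) show ?thesis by (auto simp: outcome_def)
  qed
  with \<tau>(1) have "outcome I ((i, P) # As) Es \<sigma> \<sigma>' \<tau>"
    by (auto simp: outcome_def)
  with \<tau>(2) show "\<exists>\<tau>. outcome I ((i, P) # As) Es \<sigma> \<sigma>' \<tau> \<and> sat I (combine \<tau>) \<Psi>" by blast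
qed

text \<open>Dual principle: \<open>t\<close> is supplied by the premise only after \<open>u\<close>
  has been fixed, hence every run of \<open>P'\<close> from \<open>u\<close> must account for a run
  of \<open>P\<close>.\<close>

lemma feht_valid_E_refine:
  assumes "feht_valid I \<Phi>' As ((i, P') # Es) \<Psi>" "distinct (map fst (As @ (i, P) # Es))"
    and step: "\<And>\<sigma>. sat I (combine \<sigma>) \<Phi> \<Longrightarrow>
      \<exists>u. sat I (combine (\<sigma>(i := u))) \<Phi>' \<and> (\<forall>t. sem I P' u t \<longrightarrow> sem I P (\<sigma> i) t)"
  shows "feht_valid I \<Phi> As ((i, P) # Es) \<Psi>"
proof (rule feht_validI)
  fix \<sigma> \<sigma>' assume \<Phi>: "sat I (combine \<sigma>) \<Phi>"
    and As: "\<forall>(j, Q) \<in> set As. sem I Q (\<sigma> j) (\<sigma>' j)"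
  then obtain u where u: "sat I (combine (\<sigma>(i := u))) \<Phi>'"
    and P: "\<And>t. sem I P' u t \<Longrightarrow> sem I P (\<sigma> i) t"
    using step by blast
  have fresh: "(i, R) \<notin> set As" "(i, R) \<notin> set Es" for R using assms(2) by force+
  obtain \<tau> where \<tau>: "outcome I As ((i, P') # Es) (\<sigma>(i := u)) \<sigma>' \<tau>" "sat I (combine \<tau>) \<Psi>"
  proof (rule feht_validE[OF assms(1) _ u])
    show "fst ` set As \<inter> fst ` set ((i, P') # Es) = {}" using assms(2) by auto
    show "sem I Q ((\<sigma>(i := u)) j) (\<sigma>' j)" if "(j, Q) \<in> set As" for j Q
      using that As fresh by (cases "j = i") auto
  qed
  have "sem I Q (\<sigma> j) (\<tau> j)" if "(j, Q) \<in> set Es" for j Q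
  proof -
    from that fresh have "j \<noteq> i" by blast
    with that \<tau>(1) show ?thesis by (auto simp: outcome_def)
  qed
  with \<tau>(1) P have "outcome I As ((i, P) # Es) \<sigma> \<sigma>' \<tau>"
    by (auto simp: outcome_def)
  with \<tau>(2) show "\<exists>\<tau>. outcome I As ((i, P) # Es) \<sigma> \<sigma>' \<tau> \<and> sat I (combine \<tau>) \<Psi>" by blast
qed

section \<open>Removing \<open>Skip\<close>, splitting preconditions, consequence\<close>

lemma feht_valid_A_Skip:
  assumes "feht_valid I \<Phi> As Es \<Psi>" "distinct (map fst (((i, Skip) # As) @ Es))"
  shows "feht_valid I \<Phi> ((i, Skip) # As) Es \<Psi>"
proof (rule feht_validI)
  fix \<sigma> \<sigma>' assume \<Phi>: "sat I (combine \<sigma>) \<Phi>"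
    and As: "\<forall>(j, Q) \<in> set ((i, Skip) # As). sem I Q (\<sigma> j) (\<sigma>' j)"
  obtain \<tau> where \<tau>: "outcome I As Es \<sigma> \<sigma>' \<tau>" "sat I (combine \<tau>) \<Psi>"
    by (rule feht_validE[OF assms(1) _ \<Phi>, where \<sigma>' = \<sigma>']) (use assms(2) As in auto)
  \<comment> \<open>In the shorter tuple copy \<open>i\<close> carries no program and keeps its
    initial value, which is where \<open>Skip\<close> ends.\<close>
  from As have "\<sigma>' i = \<sigma> i" by auto
  with \<tau>(1) assms(2) have "outcome I ((i, Skip) # As) Es \<sigma> \<sigma>' \<tau>" by (auto simp: outcome_def)
  with \<tau>(2) show "\<exists>\<tau>. outcome I ((i, Skip) # As) Es \<sigma> \<sigma>' \<tau> \<and> sat I (combine \<tau>) \<Psi>" by blast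
qed

lemma feht_valid_E_Skip:
  assumes "feht_valid I \<Phi> As Es \<Psi>" "distinct (map fst (As @ (i, Skip) # Es))"
  shows "feht_valid I \<Phi> As ((i, Skip) # Es) \<Psi>"
proof (rule feht_validI)
  fix \<sigma> \<sigma>' assume \<Phi>: "sat I (combine \<sigma>) \<Phi>"
    and As: "\<forall>(j, Q) \<in> set As. sem I Q (\<sigma> j) (\<sigma>' j)"
  obtain \<tau> where \<tau>: "outcome I As Es \<sigma> \<sigma>' \<tau>" "sat I (combine \<tau>) \<Psi>"
    by (rule feht_validE[OF assms(1) _ \<Phi>, where \<sigma>' = \<sigma>']) (use assms(2) As in auto)
  from \<tau>(1) assms(2) have "\<tau> i = \<sigma> i" by (auto simp: outcome_def)
  with \<tau>(1) have "outcome I As ((i, Skip) # Es) \<sigma> \<sigma>' \<tau>"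
    by (auto simp: outcome_def intro: sem.Skip)
  with \<tau>(2) show "\<exists>\<tau>. outcome I As ((i, Skip) # Es) \<sigma> \<sigma>' \<tau> \<and> sat I (combine \<tau>) \<Psi>" by blast
qed

text \<open>For the If rules: the initial state decides \<Theta>, and under each assumption the
  conditional refines to one branch.\<close>

lemma feht_valid_pre_cases:
  assumes "feht_valid I (And \<Phi> \<Theta>) As Es \<Psi>" "feht_valid I (And \<Phi> (Neg \<Theta>)) As Es \<Psi>"
  shows "feht_valid I \<Phi> As Es \<Psi>"
  unfolding feht_valid_def
proof (intro allI impI)
  fix \<sigma> \<sigma>'
  assume "sat I (combine \<sigma>) \<Phi> \<and> (\<forall>(i, P) \<in> set As. sem I P (\<sigma> i) (\<sigma>' i))"
  then show "\<exists>\<tau>. (\<forall>(i, P) \<in> set Es. sem I P (\<sigma> i) (\<tau> i)) \<and>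
        sat I (combine (\<lambda>i. if i \<in> fst ` set As then \<sigma>' i
                            else if i \<in> fst ` set Es then \<tau> i
                            else \<sigma> i)) \<Psi>"
    using assms unfolding feht_valid_def by (cases "sat I (combine \<sigma>) \<Theta>") simp_all
qed

lemma feht_valid_conseq:
  "entails I \<Phi> \<Phi>' \<Longrightarrow> feht_valid I \<Phi>' As Es \<Psi>' \<Longrightarrow> entails I \<Psi>' \<Psi> \<Longrightarrow> feht_valid I \<Phi> As Es \<Psi>"
  unfolding feht_valid_def entails_def by meson

section \<open>Counting-based loop alignment\<close>

declare upt_Suc [simp del]

text \<open>Loop execution with its exact number of iterations, which serves as the induction
  measure.\<close>

primrec while_in ::
    "('f, 'r) interp \<Rightarrow> ('f, 'r, 'v) bexp \<Rightarrow> ('f, 'r, 'v) prog \<Rightarrow> nat \<Rightarrow> 'v state \<Rightarrow> 'v state \<Rightarrow> bool"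
  where
  "while_in I b P 0 s t \<longleftrightarrow> \<not> eval_bexp I s b \<and> t = s"
| "while_in I b P (Suc n) s t \<longleftrightarrow> eval_bexp I s b \<and> (\<exists>u. sem I P s u \<and> while_in I b P n u t)"

lemma sem_While_while_in: "sem I (While b P) s t \<Longrightarrow> \<exists>n. while_in I b P n s t"
proof (induction "While b P" s t rule: sem.induct)
  case (WhileFalse s)
  then have "while_in I b P 0 s s" by simp
  then show ?case ..
next
  case (WhileTrue s t u)
  then obtain n where "while_in I b P n t u" by blast
  with WhileTrue have "while_in I b P (Suc n) s u" by auto
  then show ?case ..
qed

lemma while_in_step:
  assumes "while_in I b P n s t" "eval_bexp I s b"
  shows "\<exists>u m. m < n \<and> sem I P s u \<and> while_in I b P m u t"
  using assms by (cases n) auto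

lemma while_in_exit: "while_in I b P n s t \<Longrightarrow> \<not> eval_bexp I s b \<Longrightarrow> t = s"
  by (cases n) auto

text \<open>\<open>A\<close> and \<open>E\<close> index all loops, \<open>as\<close> and
  \<open>es\<close> those active in this round. An active universal loop consumes the next iteration
  of its recorded run; an active existential loop gains an iteration that can be put in front of any
  later run; idle loops do not move.\<close>

lemma counting_round:
  fixes ix :: "nat \<Rightarrow> nat"
  assumes inj: "inj_on ix (A \<union> E)" and disj: "A \<inter> E = {}"
    and sub: "set as \<subseteq> A" "set es \<subseteq> E"
    and valid: "feht_valid I \<Phi> (map (\<lambda>i. (ix i, P i)) as) (map (\<lambda>i. (ix i, P i)) es) \<Psi>"
    and \<Phi>: "sat I (combine \<sigma>) \<Phi>"
    and guards: "\<And>i. i \<in> set as \<union> set es \<Longrightarrow> eval_bexp I (\<sigma> (ix i)) (b i)"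
    and runs: "\<And>i. i \<in> A \<Longrightarrow> while_in I (b i) (P i) (n i) (\<sigma> (ix i)) (\<rho> i)"
  obtains \<tau> m where "sat I (combine \<tau>) \<Psi>"
    and "\<And>i. i \<in> A \<Longrightarrow> while_in I (b i) (P i) (m i) (\<tau> (ix i)) (\<rho> i)"
    and "\<And>i. i \<in> A \<Longrightarrow> m i \<le> n i" and "\<And>i. i \<in> set as \<Longrightarrow> m i < n i"
    and "\<And>i t. i \<in> E \<Longrightarrow> sem I (While (b i) (P i)) (\<tau> (ix i)) t
      \<Longrightarrow> sem I (While (b i) (P i)) (\<sigma> (ix i)) t"
    and "\<And>p. p \<notin> ix ` (A \<union> E) \<Longrightarrow> \<tau> p = \<sigma> p"
proof -
  let ?As = "map (\<lambda>i. (ix i, P i)) as" and ?Es = "map (\<lambda>i. (ix i, P i)) es"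
  have "\<forall>i \<in> set as. \<exists>u m. m < n i \<and> sem I (P i) (\<sigma> (ix i)) u \<and> while_in I (b i) (P i) m u (\<rho> i)"
    using sub guards runs while_in_step by blast
  then obtain u m where um: "\<And>i. i \<in> set as \<Longrightarrow>
      m i < n i \<and> sem I (P i) (\<sigma> (ix i)) (u i) \<and> while_in I (b i) (P i) (m i) (u i) (\<rho> i)"
    by metis
  have ix_iff: "ix i = ix j \<longleftrightarrow> i = j" if "i \<in> A \<union> E" "j \<in> A \<union> E" for i j
    using inj that by (auto dest: inj_onD)
  have mem: "ix i \<in> ix ` S \<longleftrightarrow> i \<in> S" if "i \<in> A \<union> E" "S \<subseteq> A \<union> E" for i S
    using that ix_iff by blast
  \<comment> \<open>\<open>u\<close> is indexed by loops but final states by copies; the inverse of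
    the injective \<open>ix\<close> translates.\<close>
  define \<sigma>' where "\<sigma>' p = u (inv_into (A \<union> E) ix p)" for p
  have \<sigma>': "\<sigma>' (ix i) = u i" if "i \<in> A \<union> E" for i
    using inv_into_f_f[OF inj that] by (simp add: \<sigma>'_def)
  have fst_sets: "fst ` set ?As = ix ` set as" "fst ` set ?Es = ix ` set es"
    by (auto simp: image_image)
  obtain \<tau> where \<tau>: "outcome I ?As ?Es \<sigma> \<sigma>' \<tau>" "sat I (combine \<tau>) \<Psi>"
  proof (rule feht_validE[OF valid _ \<Phi>])
    show "fst ` set ?As \<inter> fst ` set ?Es = {}"
      unfolding fst_sets using disj sub ix_iff by blast
    show "sem I Q (\<sigma> j) (\<sigma>' j)" if "(j, Q) \<in> set ?As" for j Q
      using that um \<sigma>' sub by auto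
  qed
  have \<tau>_as: "\<tau> (ix i) = u i" if "i \<in> set as" for i
    using \<tau>(1) that \<sigma>' sub by (auto simp: outcome_def)
  have \<tau>_es: "sem I (P i) (\<sigma> (ix i)) (\<tau> (ix i))" if "i \<in> set es" for i
    using \<tau>(1) that by (auto simp: outcome_def)
  have \<tau>_other: "\<tau> p = \<sigma> p" if "p \<notin> ix ` set as" "p \<notin> ix ` set es" for p
    using \<tau>(1) that unfolding outcome_def fst_sets by blast
  have \<tau>_idle: "\<tau> (ix i) = \<sigma> (ix i)" if "i \<in> A \<union> E" "i \<notin> set as" "i \<notin> set es" for i
    using that sub mem[of i "set as"] mem[of i "set es"] by (intro \<tau>_other) blast+
  define m' where "m' i = (if i \<in> set as then m i else n i)" for i
  show thesis
  proof (rule that[of \<tau> m'])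
    show "sat I (combine \<tau>) \<Psi>" by (fact \<tau>(2))
    show "while_in I (b i) (P i) (m' i) (\<tau> (ix i)) (\<rho> i)" if "i \<in> A" for i
    proof (cases "i \<in> set as")
      case True
      then show ?thesis using um \<tau>_as by (simp add: m'_def)
    next
      case False
      then have "\<tau> (ix i) = \<sigma> (ix i)" using that disj sub by (intro \<tau>_idle) auto
      then show ?thesis using False runs[OF that] by (simp add: m'_def)
    qed
    show "m' i \<le> n i" for i using um[of i] by (auto simp: m'_def)
    show "m' i < n i" if "i \<in> set as" for i using um[OF that] that by (simp add: m'_def)
    show "sem I (While (b i) (P i)) (\<sigma> (ix i)) t"
      if "i \<in> E" "sem I (While (b i) (P i)) (\<tau> (ix i)) t" for i t
    proof (cases "i \<in> set es")
      case True
      \<comment> \<open>The guard holds before the round, so the body run becomes the first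
        iteration of the longer loop run.\<close>
      then show ?thesis using that guards \<tau>_es by (auto intro: sem.WhileTrue)
    next
      case False
      then have "\<tau> (ix i) = \<sigma> (ix i)" using that disj sub by (intro \<tau>_idle) auto
      then show ?thesis using that by simp
    qed
    show "\<tau> p = \<sigma> p" if "p \<notin> ix ` (A \<union> E)" for p
      using that sub by (intro \<tau>_other) auto
  qed
qed

text \<open>The universal runs, with counts \<open>n\<close> and exit states \<open>\<rho>\<close>,
  are fixed in advance and the existential runs are built to match. Both \<open>n\<close> and
  \<open>\<sigma>\<close> vary in the induction, as each pass through the \<open>B\<close> rounds
  ends in a new state satisfying \<open>Inv\<close>.\<close>

lemma counting_loop:
  fixes ix c :: "nat \<Rightarrow> nat" and k l B :: nat
  assumes k: "k \<ge> 1" and inj: "inj_on ix {1..k + l}"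
    and agree: "\<And>i j. i \<in> {1..k + l} \<Longrightarrow> j \<in> {1..k + l}
      \<Longrightarrow> entails I Inv (Iff (guard_at (ix i) (b i)) (guard_at (ix j) (b j)))"
    and c: "\<And>i. i \<in> {1..k + l} \<Longrightarrow> c i \<in> {1..B}"
    and J: "J 1 = Inv" "J (B + 1) = Inv"
    and rounds: "\<And>j. j \<in> {1..B} \<Longrightarrow>
      feht_valid I
        (And (J j)
          (Conj (map (\<lambda>i. guard_at (ix i) (b i)) (filter (\<lambda>i. c i \<ge> j) [1..<k + l + 1]))))
        (map (\<lambda>i. (ix i, P i)) (filter (\<lambda>i. c i \<ge> j) [1..<k + 1]))
        (map (\<lambda>i. (ix i, P i)) (filter (\<lambda>i. c i \<ge> j) [k + 1..<k + l + 1]))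
        (And (J (j + 1))
          (Conj (map (\<lambda>i. guard_at (ix i) (b i)) (filter (\<lambda>i. c i > j) [1..<k + l + 1]))))"
    and "sat I (combine \<sigma>) Inv"
    and "\<And>i. i \<in> {1..k} \<Longrightarrow> while_in I (b i) (P i) (n i) (\<sigma> (ix i)) (\<rho> i)"
  shows "\<exists>\<tau>. sat I (combine \<tau>) Inv \<and> (\<forall>i \<in> {1..k + l}. \<not> eval_bexp I (\<tau> (ix i)) (b i)) \<and>
    (\<forall>i \<in> {1..k}. \<tau> (ix i) = \<rho> i) \<and>
    (\<forall>i \<in> {k + 1..k + l}. sem I (While (b i) (P i)) (\<sigma> (ix i)) (\<tau> (ix i))) \<and>
    (\<forall>p. p \<notin> ix ` {1..k + l} \<longrightarrow> \<tau> p = \<sigma> p)"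
  using assms(8,9)
proof (induction "n 1" arbitrary: n \<sigma> rule: less_induct)
  case less
  \<comment> \<open>Comparing every guard with that of loop 1 lets one case distinction decide
    whether all loops exit or all continue.\<close>
  have agree_iff: "eval_bexp I (\<sigma> (ix i)) (b i) = eval_bexp I (\<sigma> (ix 1)) (b 1)"
    if "i \<in> {1..k + l}" for i
    using agree[OF that, of 1] k less.prems(1) by (auto simp: entails_def Iff_def)
  have union: "{1..k} \<union> {k + 1..k + l} = {1..k + l}" by auto
  show ?case
  proof (cases "eval_bexp I (\<sigma> (ix 1)) (b 1)")
    case False
    then have off: "\<not> eval_bexp I (\<sigma> (ix i)) (b i)" if "i \<in> {1..k + l}" for i
      using agree_iff that by blast
    have "\<sigma> (ix i) = \<rho> i" if "i \<in> {1..k}" for i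
      using while_in_exit[OF less.prems(2)[OF that]] off that by auto
    with off less.prems(1) show ?thesis
      by (intro exI[of _ \<sigma>]) (auto intro: sem.WhileFalse)
  next
    case True
    \<comment> \<open>\<open>?G j\<close> asserts the guards of the loops still active after round
      \<open>j\<close>: all of them for \<open>j = 0\<close>, since \<open>c i \<ge> 1\<close>, and
      none for \<open>j = B\<close>.\<close>
    let ?G = "\<lambda>j. Conj (map (\<lambda>i. guard_at (ix i) (b i)) (filter (\<lambda>i. c i > j) [1..<k + l + 1]))"
    \<comment> \<open>The situation after \<open>j\<close> rounds. The existential clause looks
      backwards: final states are not yet known, so any completion from \<open>\<tau>\<close> must
      give one from \<open>\<sigma>\<close>.\<close>
    have "\<exists>\<tau> m. sat I (combine \<tau>) (And (J (j + 1)) (?G j)) \<and>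
        (\<forall>i \<in> {1..k}. while_in I (b i) (P i) (m i) (\<tau> (ix i)) (\<rho> i) \<and> m i \<le> n i) \<and>
        (j \<ge> 1 \<longrightarrow> m 1 < n 1) \<and>
        (\<forall>i \<in> {k + 1..k + l}. \<forall>t. sem I (While (b i) (P i)) (\<tau> (ix i)) t \<longrightarrow>
            sem I (While (b i) (P i)) (\<sigma> (ix i)) t) \<and>
        (\<forall>p. p \<notin> ix ` {1..k + l} \<longrightarrow> \<tau> p = \<sigma> p)" if "j \<le> B" for j
      using that
    proof (induction j)
      case 0
      have "sat I (combine \<sigma>) (And (J (0 + 1)) (?G 0))"
        using True agree_iff less.prems(1) J(1) by (auto simp: sat_Conj)
      with less.prems(2) show ?case by (intro exI[of _ \<sigma>] exI[of _ n]) auto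
    next
      case (Suc j)
      then have "j \<le> B" by simp
      from Suc.IH[OF this] obtain \<tau> m where
        sat: "sat I (combine \<tau>) (And (J (j + 1)) (?G j))"
        and runs: "\<forall>i \<in> {1..k}. while_in I (b i) (P i) (m i) (\<tau> (ix i)) (\<rho> i) \<and> m i \<le> n i"
        and lt: "j \<ge> 1 \<longrightarrow> m 1 < n 1"
        and ex_back: "\<forall>i \<in> {k + 1..k + l}. \<forall>t. sem I (While (b i) (P i)) (\<tau> (ix i)) t \<longrightarrow>
            sem I (While (b i) (P i)) (\<sigma> (ix i)) t"
        and other: "\<forall>p. p \<notin> ix ` {1..k + l} \<longrightarrow> \<tau> p = \<sigma> p"
        by (elim exE conjE) rule
      have le: "m i \<le> n i" if "i \<in> {1..k}" for i using runs that by blast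
      let ?as = "filter (\<lambda>i. c i \<ge> j + 1) [1..<k + 1]"
      let ?es = "filter (\<lambda>i. c i \<ge> j + 1) [k + 1..<k + l + 1]"
      \<comment> \<open>\<open>c i > j\<close> is \<open>c i \<ge> j + 1\<close>: the guards left by
        round \<open>j\<close> are those demanded by round \<open>j + 1\<close>.\<close>
      have valid: "feht_valid I (And (J (j + 1)) (?G j))
          (map (\<lambda>i. (ix i, P i)) ?as) (map (\<lambda>i. (ix i, P i)) ?es)
          (And (J (j + 1 + 1)) (?G (j + 1)))"
        using rounds[of "j + 1"] Suc.prems by (simp add: Suc_le_eq)
      have guards: "eval_bexp I (\<tau> (ix i)) (b i)" if "i \<in> set ?as \<union> set ?es" for i
        using sat that by (auto simp: sat_Conj)
      obtain \<tau>' m' where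
        "sat I (combine \<tau>') (And (J (j + 1 + 1)) (?G (j + 1)))"
        and "\<And>i. i \<in> {1..k} \<Longrightarrow> while_in I (b i) (P i) (m' i) (\<tau>' (ix i)) (\<rho> i)"
        and le': "\<And>i. i \<in> {1..k} \<Longrightarrow> m' i \<le> m i" and lt': "\<And>i. i \<in> set ?as \<Longrightarrow> m' i < m i"
        and "\<And>i t. i \<in> {k + 1..k + l} \<Longrightarrow> sem I (While (b i) (P i)) (\<tau>' (ix i)) t
          \<Longrightarrow> sem I (While (b i) (P i)) (\<tau> (ix i)) t"
        and "\<And>p. p \<notin> ix ` {1..k + l} \<Longrightarrow> \<tau>' p = \<tau> p"
        by (rule counting_round[where A = "{1..k}" and E = "{k + 1..k + l}" and as = ?as and es = ?es
              and ix = ix and \<sigma> = \<tau> and b = b and \<rho> = \<rho> and n = m, unfolded union,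
              OF inj _ _ _ valid sat guards])
          (use runs in auto)
      moreover have "m' i \<le> n i" if "i \<in> {1..k}" for i
        using le[OF that] le'[OF that] by simp
      \<comment> \<open>Loop 1 takes part in the first round because \<open>c 1 \<ge> 1\<close>;
        later rounds never raise its count.\<close>
      moreover have "m' 1 < n 1"
      proof (cases "j = 0")
        case True
        then have "1 \<in> set ?as" using k c[of 1] by auto
        from lt'[OF this] le[of 1] k show ?thesis by simp
      next
        case False
        with lt le'[of 1] k show ?thesis by fastforce
      qed
      ultimately show ?case
        using ex_back other by (intro exI[of _ \<tau>'] exI[of _ m']) auto
    qed
    from this[OF order_refl] obtain \<tau> m where
      sat: "sat I (combine \<tau>) (And (J (B + 1)) (?G B))"
      and runs: "\<forall>i \<in> {1..k}. while_in I (b i) (P i) (m i) (\<tau> (ix i)) (\<rho> i) \<and> m i \<le> n i"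
      and lt: "B \<ge> 1 \<longrightarrow> m 1 < n 1"
      and ex_back: "\<forall>i \<in> {k + 1..k + l}. \<forall>t. sem I (While (b i) (P i)) (\<tau> (ix i)) t \<longrightarrow>
          sem I (While (b i) (P i)) (\<sigma> (ix i)) t"
      and other: "\<forall>p. p \<notin> ix ` {1..k + l} \<longrightarrow> \<tau> p = \<sigma> p"
      by (elim exE conjE) rule
    \<comment> \<open>\<open>J (B + 1) = Inv\<close> closes the pass. The guards are now open again,
      and the induction hypothesis covers both possibilities.\<close>
    have Inv: "sat I (combine \<tau>) Inv" using sat unfolding J(2) by simp
    have "m 1 < n 1" using lt c[of 1] k by auto
    from less.hyps[of m \<tau>, OF this Inv] runs obtain \<tau>' where
      "sat I (combine \<tau>') Inv" "\<forall>i \<in> {1..k + l}. \<not> eval_bexp I (\<tau>' (ix i)) (b i)"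
      "\<forall>i \<in> {1..k}. \<tau>' (ix i) = \<rho> i"
      "\<forall>i \<in> {k + 1..k + l}. sem I (While (b i) (P i)) (\<tau> (ix i)) (\<tau>' (ix i))"
      "\<forall>p. p \<notin> ix ` {1..k + l} \<longrightarrow> \<tau>' p = \<tau> p"
      by blast
    with ex_back other show ?thesis by (intro exI[of _ \<tau>']) auto
  qed
qed

text \<open>Each universal run is cut at its loop exit. \<open>counting_loop\<close> aligns the
  exits, the tuple of the suffixes applies there, and every existential loop run is composed with
  its suffix run.\<close>

lemma feht_valid_loop_counting:
  fixes ix c :: "nat \<Rightarrow> nat" and k l B :: nat
  assumes k: "k \<ge> 1" and inj: "inj_on ix {1..k + l}"
    and \<Phi>: "entails I \<Phi> Inv"
    and agree: "\<And>i j. i \<in> {1..k + l} \<Longrightarrow> j \<in> {1..k + l}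
      \<Longrightarrow> entails I Inv (Iff (guard_at (ix i) (b i)) (guard_at (ix j) (b j)))"
    and c: "\<And>i. i \<in> {1..k + l} \<Longrightarrow> c i \<in> {1..B}"
    and J: "J 1 = Inv" "J (B + 1) = Inv"
    and rounds: "\<And>j. j \<in> {1..B} \<Longrightarrow>
      feht_valid I
        (And (J j)
          (Conj (map (\<lambda>i. guard_at (ix i) (b i)) (filter (\<lambda>i. c i \<ge> j) [1..<k + l + 1]))))
        (map (\<lambda>i. (ix i, P i)) (filter (\<lambda>i. c i \<ge> j) [1..<k + 1]))
        (map (\<lambda>i. (ix i, P i)) (filter (\<lambda>i. c i \<ge> j) [k + 1..<k + l + 1]))
        (And (J (j + 1))
          (Conj (map (\<lambda>i. guard_at (ix i) (b i)) (filter (\<lambda>i. c i > j) [1..<k + l + 1]))))"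
    and exit: "feht_valid I
        (And Inv (Conj (map (\<lambda>i. Neg (guard_at (ix i) (b i))) [1..<k + l + 1])))
        (map (\<lambda>i. (ix i, Q i)) [1..<k + 1])
        (map (\<lambda>i. (ix i, Q i)) [k + 1..<k + l + 1])
        \<Psi>"
  shows "feht_valid I \<Phi>
      (map (\<lambda>i. (ix i, While (b i) (P i) ;; Q i)) [1..<k + 1])
      (map (\<lambda>i. (ix i, While (b i) (P i) ;; Q i)) [k + 1..<k + l + 1])
      \<Psi>"
    (is "feht_valid I \<Phi> ?As ?Es \<Psi>")
proof (rule feht_validI)
  fix \<sigma> \<sigma>' assume "sat I (combine \<sigma>) \<Phi>" and As: "\<forall>(i, P) \<in> set ?As. sem I P (\<sigma> i) (\<sigma>' i)"
  then have Inv: "sat I (combine \<sigma>) Inv" using \<Phi> by (simp add: entails_def)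
  have "\<exists>r n. while_in I (b i) (P i) n (\<sigma> (ix i)) r \<and> sem I (Q i) r (\<sigma>' (ix i))"
    if "i \<in> {1..k}" for i
  proof -
    have "sem I (While (b i) (P i) ;; Q i) (\<sigma> (ix i)) (\<sigma>' (ix i))"
      using As that by (simp add: less_Suc_eq_le)
    then show ?thesis using sem_While_while_in by blast
  qed
  then obtain \<rho> n where
    runs: "\<And>i. i \<in> {1..k} \<Longrightarrow> while_in I (b i) (P i) (n i) (\<sigma> (ix i)) (\<rho> i)"
    and suffix: "\<And>i. i \<in> {1..k} \<Longrightarrow> sem I (Q i) (\<rho> i) (\<sigma>' (ix i))"
    by metis
  from counting_loop[OF k inj agree c J rounds Inv runs] obtain \<tau> where
    \<tau>: "sat I (combine \<tau>) Inv" "\<forall>i \<in> {1..k + l}. \<not> eval_bexp I (\<tau> (ix i)) (b i)"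
      "\<forall>i \<in> {1..k}. \<tau> (ix i) = \<rho> i"
      "\<forall>i \<in> {k + 1..k + l}. sem I (While (b i) (P i)) (\<sigma> (ix i)) (\<tau> (ix i))"
      "\<forall>p. p \<notin> ix ` {1..k + l} \<longrightarrow> \<tau> p = \<sigma> p"
    by blast
  let ?As' = "map (\<lambda>i. (ix i, Q i)) [1..<k + 1]"
  let ?Es' = "map (\<lambda>i. (ix i, Q i)) [k + 1..<k + l + 1]"
  have pre: "sat I (combine \<tau>)
      (And Inv (Conj (map (\<lambda>i. Neg (guard_at (ix i) (b i))) [1..<k + l + 1])))"
    using \<tau>(1,2) by (auto simp: sat_Conj)
  have copies: "fst ` set ?As' = ix ` {1..k}" "fst ` set ?Es' = ix ` {k + 1..k + l}"
      "fst ` set ?As = ix ` {1..k}" "fst ` set ?Es = ix ` {k + 1..k + l}"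
    by (auto simp: image_image)
  obtain \<tau>' where \<tau>': "outcome I ?As' ?Es' \<tau> \<sigma>' \<tau>'" "sat I (combine \<tau>') \<Psi>"
  proof (rule feht_validE[OF exit _ pre])
    have "ix ` {1..k} \<inter> ix ` {k + 1..k + l} = ix ` ({1..k} \<inter> {k + 1..k + l})"
      by (rule inj_on_image_Int[OF inj, symmetric]) auto
    then show "fst ` set ?As' \<inter> fst ` set ?Es' = {}" unfolding copies by simp
    show "sem I R (\<tau> j) (\<sigma>' j)" if "(j, R) \<in> set ?As'" for j R
      using that \<tau>(3) suffix by auto
  qed
  have "outcome I ?As ?Es \<sigma> \<sigma>' \<tau>'"
    unfolding outcome_def copies
  proof (intro conjI allI impI)
    show "\<forall>p \<in> ix ` {1..k}. \<tau>' p = \<sigma>' p"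
      using \<tau>'(1) unfolding outcome_def copies by blast
    have "sem I (While (b i) (P i) ;; Q i) (\<sigma> (ix i)) (\<tau>' (ix i))" if "i \<in> {k + 1..k + l}" for i
      using \<tau>'(1) \<tau>(4) that by (auto simp: outcome_def intro!: sem.Seq)
    then show "\<forall>(p, R) \<in> set ?Es. sem I R (\<sigma> p) (\<tau>' p)" by auto
    fix p assume p: "p \<notin> ix ` {1..k}" "p \<notin> ix ` {k + 1..k + l}"
    then have "p \<notin> ix ` {1..k + l}" by force
    with \<tau>(5) \<tau>'(1) p show "\<tau>' p = \<sigma> p" unfolding outcome_def copies by metis
  qed
  with \<tau>'(2) show "\<exists>\<tau>. outcome I ?As ?Es \<sigma> \<sigma>' \<tau> \<and> sat I (combine \<tau>) \<Psi>" by blast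
qed

section \<open>Soundness\<close>

text \<open>\<open>distinct_copies\<close> says that the programs of a tuple operate on pairwise
  different copies. Every rule passes this from its conclusion to its premises, so the induction
  hypotheses apply.\<close>

theorem theorem1:
  fixes I :: "('f, 'r) interp"
    and H U :: "('f, 'r, 'v ivar) form \<Rightarrow> ('f, 'r, 'v ivar) prog \<Rightarrow> ('f, 'r, 'v ivar) form \<Rightarrow> bool"
    and \<Phi> \<Psi> :: "('f, 'r, 'v ivar) form"
    and As Es :: "('f, 'r, 'v) iprog list"
  assumes hoare_sound: "\<And>\<Phi> P \<Phi>'. H \<Phi> P \<Phi>' \<Longrightarrow> hoare_valid I \<Phi> P \<Phi>'"
    and under_sound: "\<And>\<Phi> P \<Phi>'. U \<Phi> P \<Phi>' \<Longrightarrow> under_valid I \<Phi> P \<Phi>'"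
    and distinct_copies: "distinct (map fst (As @ Es))"
    and derivable: "fehl I H U \<Phi> As Es \<Psi>"
  shows "feht_valid I \<Phi> As Es \<Psi>"
  using derivable distinct_copies
proof (induction rule: fehl.induct)
  case (A_Reorder As As' \<Phi> Es \<Psi>)
  then have "set As = set As'" by (metis set_mset_mset)
  moreover have "distinct (map fst (As' @ Es))"
    using A_Reorder.prems A_Reorder.hyps(1) mset_eq_imp_distinct_iff[of "map fst (As @ Es)"]
    by (metis map_append mset_append mset_map)
  ultimately show ?case
    using A_Reorder.IH unfolding feht_valid_def \<open>set As = set As'\<close> by blast
next
  case (E_Reorder Es Es' \<Phi> As \<Psi>)
  then have "set Es = set Es'" by (metis set_mset_mset)
  moreover have "distinct (map fst (As @ Es'))"
    using E_Reorder.prems E_Reorder.hyps(1) mset_eq_imp_distinct_iff[of "map fst (As @ Es)"]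
    by (metis map_append mset_append mset_map)
  ultimately show ?case
    using E_Reorder.IH unfolding feht_valid_def \<open>set Es = set Es'\<close> by blast
next
  case (A_Skip_I \<Phi> i P As Es \<Psi>)
  from A_Skip_I.prems have "feht_valid I \<Phi> ((i, P ;; Skip) # As) Es \<Psi>"
    by (intro A_Skip_I.IH) simp
  \<comment> \<open>The witness \<open>_ i\<close> is \<open>\<sigma> i\<close>: the state does not
    move, as \<open>\<sigma>(i := \<sigma> i) = \<sigma>\<close>. It recurs in the other rules that
    leave the state unchanged.\<close>
  then show ?case
    using A_Skip_I.prems by (rule feht_valid_A_refine) (auto intro!: exI[of _ "_ i"] sem.intros)
next
  case (E_Skip_I \<Phi> As i P Es \<Psi>)
  from E_Skip_I.prems have "feht_valid I \<Phi> As ((i, P ;; Skip) # Es) \<Psi>"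
    by (intro E_Skip_I.IH) simp
  then show ?case
    using E_Skip_I.prems by (rule feht_valid_E_refine) (auto intro!: exI[of _ "_ i"])
next
  case (A_Skip_E \<Phi> As Es \<Psi> i)
  then show ?case by (intro feht_valid_A_Skip) auto
next
  case (E_Skip_E \<Phi> As Es \<Psi> i)
  then show ?case by (intro feht_valid_E_Skip) auto
next
  case (A_Assoc \<Phi> i P1 P2 P3 As Es \<Psi>)
  from A_Assoc.prems have "feht_valid I \<Phi> ((i, P1 ;; (P2 ;; P3)) # As) Es \<Psi>"
    by (intro A_Assoc.IH) simp
  then show ?case
    using A_Assoc.prems
    by (rule feht_valid_A_refine) (auto intro!: exI[of _ "_ i"] intro: sem.Seq)
next
  case (E_Assoc \<Phi> As i P1 P2 P3 Es \<Psi>)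
  from E_Assoc.prems have "feht_valid I \<Phi> As ((i, P1 ;; (P2 ;; P3)) # Es) \<Psi>"
    by (intro E_Assoc.IH) simp
  then show ?case
    using E_Assoc.prems
    by (rule feht_valid_E_refine) (auto intro!: exI[of _ "_ i"] intro: sem.Seq)
next
  case (Done \<Phi>)
  show ?case by (rule feht_validI) (auto simp: outcome_def)
next
  case (Cons \<Phi> \<Phi>' As Es \<Psi>' \<Psi>)
  then show ?case by (blast intro: feht_valid_conseq)
next
  case (A_If \<Phi> i b P1 P3 As Es \<Psi> P2)
  from A_If.prems have *:
    "feht_valid I (And \<Phi> (guard_at i b)) ((i, P1 ;; P3) # As) Es \<Psi>"
    "feht_valid I (And \<Phi> (Neg (guard_at i b))) ((i, P2 ;; P3) # As) Es \<Psi>"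
    by (auto intro!: A_If.IH)
  show ?case
  proof (rule feht_valid_pre_cases)
    show "feht_valid I (And \<Phi> (guard_at i b)) ((i, prog.If b P1 P2 ;; P3) # As) Es \<Psi>"
      using *(1) A_If.prems
      by (rule feht_valid_A_refine) (auto intro!: exI[of _ "_ i"] intro: sem.Seq)
    show "feht_valid I (And \<Phi> (Neg (guard_at i b))) ((i, prog.If b P1 P2 ;; P3) # As) Es \<Psi>"
      using *(2) A_If.prems
      by (rule feht_valid_A_refine) (auto intro!: exI[of _ "_ i"] intro: sem.Seq)
  qed
next
  case (E_If \<Phi> i b As P1 P3 Es \<Psi> P2)
  from E_If.prems have *:
    "feht_valid I (And \<Phi> (guard_at i b)) As ((i, P1 ;; P3) # Es) \<Psi>"
    "feht_valid I (And \<Phi> (Neg (guard_at i b))) As ((i, P2 ;; P3) # Es) \<Psi>"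
    by (auto intro!: E_If.IH)
  show ?case
  proof (rule feht_valid_pre_cases)
    show "feht_valid I (And \<Phi> (guard_at i b)) As ((i, prog.If b P1 P2 ;; P3) # Es) \<Psi>"
      using *(1) E_If.prems
      by (rule feht_valid_E_refine)
        (auto intro!: exI[of _ "_ i"] intro: sem.Seq sem.IfTrue)
    show "feht_valid I (And \<Phi> (Neg (guard_at i b))) As ((i, prog.If b P1 P2 ;; P3) # Es) \<Psi>"
      using *(2) E_If.prems
      by (rule feht_valid_E_refine)
        (auto intro!: exI[of _ "_ i"] intro: sem.Seq sem.IfFalse)
  qed
next
  case (A_Step \<Phi> i P1 \<Phi>' P2 As Es \<Psi>)
  from A_Step.prems have "feht_valid I \<Phi>' ((i, P2) # As) Es \<Psi>" by (intro A_Step.IH) simp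
  then show ?case
    using A_Step.prems
  proof (rule feht_valid_A_refine)
    fix \<sigma> t assume "sat I (combine \<sigma>) \<Phi>" "sem I (P1 ;; P2) (\<sigma> i) t"
    with hoare_sound[OF A_Step.hyps(1)]
    show "\<exists>u. sat I (combine (\<sigma>(i := u))) \<Phi>' \<and> sem I P2 u t"
      using sem_prog_at unfolding hoare_valid_def by blast
  qed
next
  case (E_Step \<Phi> i P1 \<Phi>' As P2 Es \<Psi>)
  from E_Step.prems have "feht_valid I \<Phi>' As ((i, P2) # Es) \<Psi>" by (intro E_Step.IH) simp
  then show ?case
    using E_Step.prems
  proof (rule feht_valid_E_refine)
    fix \<sigma> assume "sat I (combine \<sigma>) \<Phi>"
    with under_sound[OF E_Step.hyps(1)] obtain T
      where "sem I (prog_at i P1) (combine \<sigma>) T" "sat I T \<Phi>'"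
      unfolding under_valid_def by blast
    \<comment> \<open>\<open>sem_prog_atE\<close> identifies \<open>T\<close> as
      \<open>\<sigma>\<close> with component \<open>i\<close> updated; that component is
      \<open>u\<close>.\<close>
    then show "\<exists>u. sat I (combine (\<sigma>(i := u))) \<Phi>' \<and>
        (\<forall>t. sem I P2 u t \<longrightarrow> sem I (P1 ;; P2) (\<sigma> i) t)"
      by (metis sem_prog_atE sem.Seq)
  qed
next
  case (A_Assume \<Phi> i b P As Es \<Psi>)
  from A_Assume.prems have "feht_valid I (And \<Phi> (guard_at i b)) ((i, P) # As) Es \<Psi>"
    by (intro A_Assume.IH) simp
  then show ?case
    using A_Assume.prems by (rule feht_valid_A_refine) (auto intro!: exI[of _ "_ i"])
next
  case (E_Assume \<Phi> i b As P Es \<Psi>)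
  from E_Assume.prems have "feht_valid I \<Phi> As ((i, P) # Es) \<Psi>" by (intro E_Assume.IH) simp
  then show ?case
    using E_Assume.prems
  proof (rule feht_valid_E_refine)
    fix \<sigma> assume \<Phi>: "sat I (combine \<sigma>) \<Phi>"
    with E_Assume.hyps(1) have "eval_bexp I (\<sigma> i) b" by (auto simp: entails_def)
    with \<Phi> show "\<exists>u. sat I (combine (\<sigma>(i := u))) \<Phi> \<and>
        (\<forall>t. sem I P u t \<longrightarrow> sem I (Assume b ;; P) (\<sigma> i) t)"
      by (intro exI[of _ "\<sigma> i"]) (auto intro: sem.Seq sem.Assume)
  qed
next
  case (A_Choice x i \<Phi> P As Es \<Psi>)
  from A_Choice.prems have "feht_valid I (form.Ex (x, i) \<Phi>) ((i, P) # As) Es \<Psi>"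
    by (intro A_Choice.IH) simp
  then show ?case
    using A_Choice.prems
  proof (rule feht_valid_A_refine)
    fix \<sigma> t assume \<Phi>: "sat I (combine \<sigma>) \<Phi>" and "sem I (Choose x ;; P) (\<sigma> i) t"
    then obtain n where "sem I P ((\<sigma> i)(x := n)) t" by auto
    \<comment> \<open>The old value \<open>\<sigma> i x\<close> is the witness, undoing the
      assignment.\<close>
    moreover have "sat I (combine (\<sigma>(i := (\<sigma> i)(x := n)))) (form.Ex (x, i) \<Phi>)"
      using \<Phi> by (auto simp: combine_upd intro!: exI[of _ "\<sigma> i x"])
    ultimately show "\<exists>u. sat I (combine (\<sigma>(i := u))) (form.Ex (x, i) \<Phi>) \<and> sem I P u t" by blast
  qed
next
  case (E_Choice x i e \<Phi> As P Es \<Psi>)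
  let ?\<Phi> = "And (form.Ex (x, i) \<Phi>) (Bexp (BEq (Var (x, i)) e))"
  from E_Choice.prems have "feht_valid I ?\<Phi> As ((i, P) # Es) \<Psi>" by (intro E_Choice.IH) simp
  then show ?case
    using E_Choice.prems
  proof (rule feht_valid_E_refine)
    fix \<sigma> assume \<Phi>: "sat I (combine \<sigma>) \<Phi>"
    \<comment> \<open>The value of \<open>e\<close> before the assignment; as \<open>(x, i)\<close>
      does not occur in \<open>e\<close>, it is also the value afterwards.\<close>
    define n where "n = eval_exp I (combine \<sigma>) e"
    let ?\<tau> = "\<sigma>(i := (\<sigma> i)(x := n))"
    have "eval_exp I (combine ?\<tau>) e = n"
      unfolding n_def using E_Choice.hyps(1)
      by (intro eval_exp_cong) (auto simp: combine_def)
    moreover have "sat I (combine ?\<tau>) (form.Ex (x, i) \<Phi>)"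
      using \<Phi> by (auto simp: combine_upd intro!: exI[of _ "\<sigma> i x"])
    moreover have "combine ?\<tau> (x, i) = n" by (simp add: combine_def)
    ultimately have "sat I (combine ?\<tau>) ?\<Phi>" by simp
    then show "\<exists>u. sat I (combine (\<sigma>(i := u))) ?\<Phi> \<and>
        (\<forall>t. sem I P u t \<longrightarrow> sem I (Choose x ;; P) (\<sigma> i) t)"
      by (blast intro: sem.Seq sem.Choose)
  qed
next
  case (A_Havoc i P \<Phi> As Es \<Psi>)
  let ?\<Phi> = "Exs (mods (prog_at i P)) \<Phi>"
  \<comment> \<open>Havoc as refinement to \<open>Skip\<close>: component \<open>i\<close> moves
    straight to the final state of the run.\<close>
  from A_Havoc.prems have "feht_valid I ?\<Phi> ((i, Skip) # As) Es \<Psi>"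
    by (intro feht_valid_A_Skip A_Havoc.IH) auto
  then show ?case
    using A_Havoc.prems
    by (rule feht_valid_A_refine) (blast intro: sat_Exs_mods sem.Skip)
next
  case (E_Havoc \<Phi> i P As Es \<Psi>)
  let ?\<Phi> = "Exs (mods (prog_at i P)) \<Phi>"
  from E_Havoc.prems have "feht_valid I ?\<Phi> As ((i, Skip) # Es) \<Psi>"
    by (intro feht_valid_E_Skip E_Havoc.IH) auto
  then show ?case
    using E_Havoc.prems
  proof (rule feht_valid_E_refine)
    fix \<sigma> assume \<Phi>: "sat I (combine \<sigma>) \<Phi>"
    \<comment> \<open>With postcondition \<open>Top\<close> the triple just provides a terminating
      run, whose final state serves as \<open>u\<close>.\<close>
    with under_sound[OF E_Havoc.hyps(1)] obtain T where "sem I (prog_at i P) (combine \<sigma>) T"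
      unfolding under_valid_def by blast
    then obtain t where "sem I P (\<sigma> i) t" by (rule sem_prog_atE)
    with \<Phi> show "\<exists>u. sat I (combine (\<sigma>(i := u))) ?\<Phi> \<and>
        (\<forall>t. sem I Skip u t \<longrightarrow> sem I P (\<sigma> i) t)"
      by (blast intro: sat_Exs_mods)
  qed
next
  case (Loop_Counting k \<Phi> Inv l ix b c B J P Q \<Psi>)
  have split: "[1..<k + l + 1] = [1..<k + 1] @ [k + 1..<k + l + 1]"
    using upt_add_eq_append[of 1 "k + 1" l] by (simp add: add.commute add.left_commute)
  have dist: "distinct (map ix [1..<k + l + 1])"
    using Loop_Counting.prems unfolding split by (simp add: comp_def)
  then have inj: "inj_on ix {1..k + l}"
    by (simp add: distinct_map atLeastLessThanSuc_atLeastAtMost)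
  \<comment> \<open>The arbitrary filter \<open>S\<close> covers the rounds as well as the suffix
    tuple, which takes the constant filter.\<close>
  have sub: "distinct (map fst (map (\<lambda>i. (ix i, R i)) (filter S [1..<k + 1]) @
      map (\<lambda>i. (ix i, R i)) (filter S [k + 1..<k + l + 1])))"
    for R :: "nat \<Rightarrow> ('f, 'r, 'v) prog" and S
  proof -
    have "distinct (map ix (filter S [1..<k + l + 1]))" using dist by (rule distinct_map_filter)
    then show ?thesis unfolding split by (simp add: comp_def)
  qed
  show ?case
  proof (rule feht_valid_loop_counting[OF Loop_Counting.hyps(1) inj Loop_Counting.hyps(2,3,4)])
    show "J 1 = Inv" "J (B + 1) = Inv" using Loop_Counting.hyps(5) by auto
    show "feht_valid I
        (And Inv (Conj (map (\<lambda>i. Neg (guard_at (ix i) (b i))) [1..<k + l + 1])))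
        (map (\<lambda>i. (ix i, Q i)) [1..<k + 1]) (map (\<lambda>i. (ix i, Q i)) [k + 1..<k + l + 1]) \<Psi>"
      by (rule Loop_Counting.IH(2)) (use sub[of Q "\<lambda>_. True"] in simp)
  qed (blast intro: Loop_Counting.IH(1) sub)+
qed

end
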